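(* Let $F$ be a regular class of first order formulas and let $G$ be a digraph definable by a sentence in $F$. Then $$L_F(G)<\mathrm{Tower}\bigl(D_F(G)+\log^*D_F(G)+2\bigr).$$
   Context: A digraph is a finite non-empty vertex set with a binary arc relation (loops allowed). First order formulas about digraphs use variables over vertices, relations $=$ and $\mapsto$ (arc), $\forall,\exists,\vee,\wedge,\neg$, parentheses. A sentence defines $G$ if it is true on $G$ and false on every digraph not isomorphic to $G$. $L(\Phi)$ is the number of symbols of $\Phi$, and the quantifier rank $D(\Phi)$ is the maximum number of nested quantifiers. For a class $F$ of formulas, $L_F(G)$ (resp. $D_F(G)$) is the minimum of $L(\Phi)$ (resp. $D(\Phi)$) over sentences $\Phi\in F$ defining $G$. Writing $A(x_1,\dots,x_s)$ means $x_1,\dots,x_s$ are exactly the free variables of $A$. A formula $A(x_1,\dots,x_s)$ of quantifier rank $k-s$ is normal if all negations in $A$ occur only in front of atomic subformulas, $A$ contains occurrences of the variables $x_1,\dots,x_k$ only, and every sequence of nested quantifiers of $A$ has length $k-s$ and quantifies the variables $x_{s+1},\dots,x_k$ exactly in this order. A normal form of $A(x_1,\dots,x_s)$ is a normal formula with the same free variables and the same quantifier rank that is equivalent to $A$. A class $F$ is regular if (i) $F$ is closed under taking subformulas and under renaming bound variables; (ii) for each $A\in F$, $F$ contains a normal form of $A$; (iii) for every $k\ge1$ there is a set $P^k\subseteq\{\forall,\exists\}^k$ such that a normal sentence $A$ of quantifier rank $k$ belongs to $F$ iff every sequence of nested quantifiers of $A$ belongs to $P^k$. $\mathrm{Tower}(0)=1$,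 $\mathrm{Tower}(i)=2^{\mathrm{Tower}(i-1)}$; $\log^*n$ is the minimum number of iterations of $\log_2$ bringing $n$ to $1$ or below. *)

theory Defs
  imports
    Complex_Main
    "Graph_Theory.Pair_Digraph"
    "Graph_Theory.Digraph_Isomorphism"
begin

section \<open>Digraphs\<close>

text \<open>Loops are allowed, parallel arcs are not.\<close>

definition nonempty_digraph :: "'a pair_pre_digraph \<Rightarrow> bool" where
  "nonempty_digraph G \<longleftrightarrow> pair_fin_digraph G \<and> pverts G \<noteq> {}"

section \<open>First order formulas about digraphs\<close>

type_synonym var = nat

datatype quant = All_Q | Ex_Q

datatype fm =
    EqF var var
  | ArcF var var
  | Neg fm
  | Con fm fm
  | Dis fm fm
  | Qnt quant var fm

primrec fv :: "fm \<Rightarrow> var set" where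
  "fv (EqF x y) = {x, y}"
| "fv (ArcF x y) = {x, y}"
| "fv (Neg A) = fv A"
| "fv (Con A B) = fv A \<union> fv B"
| "fv (Dis A B) = fv A \<union> fv B"
| "fv (Qnt Q x A) = fv A - {x}"

primrec vars :: "fm \<Rightarrow> var set" where
  "vars (EqF x y) = {x, y}"
| "vars (ArcF x y) = {x, y}"
| "vars (Neg A) = vars A"
| "vars (Con A B) = vars A \<union> vars B"
| "vars (Dis A B) = vars A \<union> vars B"
| "vars (Qnt Q x A) = insert x (vars A)"

definition sentence :: "fm \<Rightarrow> bool" where
  "sentence A \<longleftrightarrow> fv A = {}"

primrec qrank :: "fm \<Rightarrow> nat" where
  "qrank (EqF x y) = 0"
| "qrank (ArcF x y) = 0"
| "qrank (Neg A) = qrank A"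
| "qrank (Con A B) = max (qrank A) (qrank B)"
| "qrank (Dis A B) = max (qrank A) (qrank B)"
| "qrank (Qnt Q x A) = Suc (qrank A)"

text \<open>
  The formula as a word. Every variable is a single symbol, and a conjunction or disjunction is
  enclosed in parentheses, which makes the notation unambiguous.
\<close>

datatype symbol =
    VarS var | EqS | ArcS | NegS | ConS | DisS | QntS quant | LParS | RParS

primrec symbols :: "fm \<Rightarrow> symbol list" where
  "symbols (EqF x y) = [VarS x, EqS, VarS y]"
| "symbols (ArcF x y) = [VarS x, ArcS, VarS y]"
| "symbols (Neg A) = NegS # symbols A"
| "symbols (Con A B) = LParS # symbols A @ ConS # symbols B @ [RParS]"
| "symbols (Dis A B) = LParS # symbols A @ DisS # symbols B @ [RParS]"
| "symbols (Qnt Q x A) = QntS Q # VarS x # symbols A"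

definition fm_length :: "fm \<Rightarrow> nat" where
  "fm_length A = length (symbols A)"

primrec subformulas :: "fm \<Rightarrow> fm set" where
  "subformulas (EqF x y) = {EqF x y}"
| "subformulas (ArcF x y) = {ArcF x y}"
| "subformulas (Neg A) = insert (Neg A) (subformulas A)"
| "subformulas (Con A B) = insert (Con A B) (subformulas A \<union> subformulas B)"
| "subformulas (Dis A B) = insert (Dis A B) (subformulas A \<union> subformulas B)"
| "subformulas (Qnt Q x A) = insert (Qnt Q x A) (subformulas A)"

primrec sat :: "'a pair_pre_digraph \<Rightarrow> (var \<Rightarrow> 'a) \<Rightarrow> fm \<Rightarrow> bool" where
  "sat G \<nu> (EqF x y) \<longleftrightarrow> \<nu> x = \<nu> y"
| "sat G \<nu> (ArcF x y) \<longleftrightarrow> (\<nu> x, \<nu> y) \<in> parcs G"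
| "sat G \<nu> (Neg A) \<longleftrightarrow> \<not> sat G \<nu> A"
| "sat G \<nu> (Con A B) \<longleftrightarrow> sat G \<nu> A \<and> sat G \<nu> B"
| "sat G \<nu> (Dis A B) \<longleftrightarrow> sat G \<nu> A \<or> sat G \<nu> B"
| "sat G \<nu> (Qnt Q x A) \<longleftrightarrow>
     (case Q of All_Q \<Rightarrow> \<forall>v\<in>pverts G. sat G (\<nu>(x := v)) A
              | Ex_Q \<Rightarrow> \<exists>v\<in>pverts G. sat G (\<nu>(x := v)) A)"

definition true_on :: "fm \<Rightarrow> 'a pair_pre_digraph \<Rightarrow> bool" where
  "true_on A G \<longleftrightarrow> (\<forall>\<nu>. range \<nu> \<subseteq> pverts G \<longrightarrow> sat G \<nu> A)"

text \<open>
  In the next two definitions the digraphs \<open>H\<close> have natural numbers as vertices; every finite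
  digraph is isomorphic to one of these.
\<close>

definition equivalent :: "fm \<Rightarrow> fm \<Rightarrow> bool" where
  "equivalent A B \<longleftrightarrow>
     (\<forall>(H :: nat pair_pre_digraph) \<nu>. nonempty_digraph H \<and> range \<nu> \<subseteq> pverts H \<longrightarrow>
        (sat H \<nu> A \<longleftrightarrow> sat H \<nu> B))"

definition defines_digraph :: "fm \<Rightarrow> 'a pair_pre_digraph \<Rightarrow> bool" where
  "defines_digraph A G \<longleftrightarrow>
     sentence A \<and> true_on A G \<and>
     (\<forall>H :: nat pair_pre_digraph.
        nonempty_digraph H \<and> \<not> digraph_iso (with_proj G) (with_proj H) \<longrightarrow> \<not> true_on A H)"

section \<open>Renaming of bound variables\<close>

text \<open>\<open>subst x y A\<close> replaces the free occurrences of \<open>x\<close> in \<open>A\<close> by \<open>y\<close>.\<close>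

primrec subst :: "var \<Rightarrow> var \<Rightarrow> fm \<Rightarrow> fm" where
  "subst x y (EqF u v) = EqF (if u = x then y else u) (if v = x then y else v)"
| "subst x y (ArcF u v) = ArcF (if u = x then y else u) (if v = x then y else v)"
| "subst x y (Neg A) = Neg (subst x y A)"
| "subst x y (Con A B) = Con (subst x y A) (subst x y B)"
| "subst x y (Dis A B) = Dis (subst x y A) (subst x y B)"
| "subst x y (Qnt Q z A) = (if z = x then Qnt Q z A else Qnt Q z (subst x y A))"

text \<open>
  One renaming step: somewhere in the formula a bound variable \<open>x\<close> is replaced by a variable \<open>y\<close>
  not occurring in its scope. As there are infinitely many variables, the steps generate all of
  alpha-equivalence.
\<close>

inductive rename_bound :: "fm \<Rightarrow> fm \<Rightarrow> bool" where
  rename: "y \<notin> vars A \<Longrightarrow> rename_bound (Qnt Q x A) (Qnt Q y (subst x y A))"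
| neg: "rename_bound A A' \<Longrightarrow> rename_bound (Neg A) (Neg A')"
| con1: "rename_bound A A' \<Longrightarrow> rename_bound (Con A B) (Con A' B)"
| con2: "rename_bound B B' \<Longrightarrow> rename_bound (Con A B) (Con A B')"
| dis1: "rename_bound A A' \<Longrightarrow> rename_bound (Dis A B) (Dis A' B)"
| dis2: "rename_bound B B' \<Longrightarrow> rename_bound (Dis A B) (Dis A B')"
| qnt: "rename_bound A A' \<Longrightarrow> rename_bound (Qnt Q x A) (Qnt Q x A')"

section \<open>Normal formulas and regular classes\<close>

fun is_atom :: "fm \<Rightarrow> bool" where
  "is_atom (EqF x y) = True"
| "is_atom (ArcF x y) = True"
| "is_atom _ = False"

primrec neg_atoms_only :: "fm \<Rightarrow> bool" where
  "neg_atoms_only (EqF x y) = True"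
| "neg_atoms_only (ArcF x y) = True"
| "neg_atoms_only (Neg A) = is_atom A"
| "neg_atoms_only (Con A B) = (neg_atoms_only A \<and> neg_atoms_only B)"
| "neg_atoms_only (Dis A B) = (neg_atoms_only A \<and> neg_atoms_only B)"
| "neg_atoms_only (Qnt Q x A) = neg_atoms_only A"

text \<open>
  The maximal sequences of nested quantifiers, outermost first, each quantifier with its variable.
  A quantifier-free formula has none.
\<close>

primrec nested_quants :: "fm \<Rightarrow> (quant \<times> var) list set" where
  "nested_quants (EqF x y) = {}"
| "nested_quants (ArcF x y) = {}"
| "nested_quants (Neg A) = nested_quants A"
| "nested_quants (Con A B) = nested_quants A \<union> nested_quants B"
| "nested_quants (Dis A B) = nested_quants A \<union> nested_quants B"
| "nested_quants (Qnt Q x A) =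
     (if nested_quants A = {} then {[(Q, x)]} else (#) (Q, x) ` nested_quants A)"

text \<open>
  In \<open>normal_wrt xs s A\<close> the list \<open>xs\<close> is \<open>x\<^sub>1, \<dots>, x\<^sub>k\<close>, of which the first \<open>s\<close> are the free
  variables of \<open>A\<close>.
\<close>

definition normal_wrt :: "var list \<Rightarrow> nat \<Rightarrow> fm \<Rightarrow> bool" where
  "normal_wrt xs s A \<longleftrightarrow>
     distinct xs \<and> s \<le> length xs \<and>
     fv A = set (take s xs) \<and> qrank A = length xs - s \<and>
     neg_atoms_only A \<and> vars A \<subseteq> set xs \<and>
     (\<forall>q \<in> nested_quants A. map snd q = drop s xs)"

definition normal_fm :: "fm \<Rightarrow> bool" where
  "normal_fm A \<longleftrightarrow> (\<exists>xs s. normal_wrt xs s A)"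

definition normal_form_of :: "fm \<Rightarrow> fm \<Rightarrow> bool" where
  "normal_form_of B A \<longleftrightarrow>
     normal_fm B \<and> fv B = fv A \<and> qrank B = qrank A \<and> equivalent B A"

definition regular_class :: "fm set \<Rightarrow> bool" where
  "regular_class F \<longleftrightarrow>
     (\<forall>A\<in>F. subformulas A \<subseteq> F) \<and>
     (\<forall>A\<in>F. \<forall>B. rename_bound A B \<longrightarrow> B \<in> F) \<and>
     (\<forall>A\<in>F. \<exists>B\<in>F. normal_form_of B A) \<and>
     (\<forall>k\<ge>1. \<exists>P \<subseteq> {p :: quant list. length p = k}.
        \<forall>A. sentence A \<and> normal_fm A \<and> qrank A = k \<longrightarrow>
          (A \<in> F \<longleftrightarrow> (\<forall>q \<in> nested_quants A. map fst q \<in> P)))"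

section \<open>Succinctness of definitions\<close>

definition definable_in :: "fm set \<Rightarrow> 'a pair_pre_digraph \<Rightarrow> bool" where
  "definable_in F G \<longleftrightarrow> (\<exists>A\<in>F. defines_digraph A G)"

definition def_length :: "fm set \<Rightarrow> 'a pair_pre_digraph \<Rightarrow> nat" where
  "def_length F G = (LEAST l. \<exists>A\<in>F. defines_digraph A G \<and> fm_length A = l)"

definition def_qrank :: "fm set \<Rightarrow> 'a pair_pre_digraph \<Rightarrow> nat" where
  "def_qrank F G = (LEAST d. \<exists>A\<in>F. defines_digraph A G \<and> qrank A = d)"

primrec tower :: "nat \<Rightarrow> nat" where
  "tower 0 = 1"
| "tower (Suc i) = 2 ^ tower i"

definition log_star :: "nat \<Rightarrow> nat" where
  "log_star n = (LEAST i. (log 2 ^^ i) (real n) \<le> 1)"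

end

theory Submission
  imports Defs
begin

text \<open>
  Let \<open>B\<close> be a normal form, of quantifier rank \<open>k\<close>, of a sentence in \<open>F\<close> defining \<open>G\<close>, and let \<open>S\<close>
  be the set of its quantifier words. Among the normal sentences with quantifier words in \<open>S\<close> that
  hold on \<open>G\<close> there is a strongest one, a Hintikka formula restricted to these words. It implies
  \<open>B\<close>, so it defines \<open>G\<close>, and it belongs to \<open>F\<close> because membership depends on the words only.
  There are at most \<open>t\<^sub>0 = 2 ^ (2 * k\<^sup>2)\<close> such formulas at the innermost level and \<open>t\<^sub>n\<^sub>+\<^sub>1 = 4 ^ t\<^sub>n\<close> one
  level further out, so the length is at most about \<open>t\<^sub>k\<^sub>-\<^sub>1\<^sup>2\<close>. The final estimate needs \<open>k \<ge> 2\<close>;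
  smaller ranks define no digraph, as such sentences do not notice a doubling of all vertices.
\<close>

section \<open>Digraphs on the natural numbers\<close>

text \<open>\<open>equivalent\<close> and \<open>defines_digraph\<close> compare with digraphs on
  the natural numbers only; injective relabelling carries their verdicts over to digraphs on any
  vertex type.\<close>

definition map_digraph :: "('a \<Rightarrow> 'b) \<Rightarrow> 'a pair_pre_digraph \<Rightarrow> 'b pair_pre_digraph" where
  "map_digraph f G = \<lparr>pverts = f ` pverts G, parcs = map_prod f f ` parcs G\<rparr>"

lemma map_digraph_simps [simp]:
  "pverts (map_digraph f G) = f ` pverts G"
  "parcs (map_digraph f G) = map_prod f f ` parcs G"
  by (simp_all add: map_digraph_def)

lemma nonempty_digraph_iff:
  "nonempty_digraph G \<longleftrightarrow>
     finite (pverts G) \<and> pverts G \<noteq> {} \<and> parcs G \<subseteq> pverts G \<times> pverts G"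
proof
  assume G: "nonempty_digraph G"
  then interpret pair_fin_digraph G
    by (simp add: nonempty_digraph_def)
  show "finite (pverts G) \<and> pverts G \<noteq> {} \<and> parcs G \<subseteq> pverts G \<times> pverts G"
    using G pair_finite_verts in_arcsD1 in_arcsD2 by (auto simp: nonempty_digraph_def)
next
  assume G: "finite (pverts G) \<and> pverts G \<noteq> {} \<and> parcs G \<subseteq> pverts G \<times> pverts G"
  then have "finite (parcs G)"
    by (meson finite_SigmaI finite_subset)
  with G have "pair_fin_digraph G"
    by unfold_locales auto
  with G show "nonempty_digraph G"
    by (simp add: nonempty_digraph_def)
qed

lemma nonempty_digraph_map: "nonempty_digraph G \<Longrightarrow> nonempty_digraph (map_digraph f G)"
  by (fastforce simp: nonempty_digraph_iff)

lemma sat_map_digraph: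
  assumes "nonempty_digraph G" "inj_on f (pverts G)" "range \<nu> \<subseteq> pverts G"
  shows "sat (map_digraph f G) (f \<circ> \<nu>) A \<longleftrightarrow> sat G \<nu> A"
  using assms(3)
proof (induction A arbitrary: \<nu>)
  case (EqF x y)
  then have "\<nu> x \<in> pverts G" "\<nu> y \<in> pverts G"
    by auto
  then show ?case
    using assms(2) by (auto simp: inj_on_def)
next
  case (ArcF x y)
  then have "\<nu> x \<in> pverts G" "\<nu> y \<in> pverts G"
    by auto
  moreover have "parcs G \<subseteq> pverts G \<times> pverts G"
    using assms(1) by (simp add: nonempty_digraph_iff)
  ultimately have "(f (\<nu> x), f (\<nu> y)) \<in> map_prod f f ` parcs G \<longleftrightarrow> (\<nu> x, \<nu> y) \<in> parcs G"
    using inj_on_image_mem_iff[OF map_prod_inj_on[OF assms(2) assms(2)], of "(\<nu> x, \<nu> y)" "parcs G"]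
    by simp
  then show ?case
    by simp
next
  case (Qnt Q x A)
  have "sat (map_digraph f G) ((f \<circ> \<nu>)(x := f v)) A \<longleftrightarrow> sat G (\<nu>(x := v)) A"
    if "v \<in> pverts G" for v
  proof -
    have "range (\<nu>(x := v)) \<subseteq> pverts G"
      using Qnt.prems that by auto
    from Qnt.IH[OF this] show ?thesis
      by (simp only: fun_upd_comp)
  qed
  then show ?case
    by (cases Q) (simp_all add: comp_def)
qed auto

lemma true_on_map_digraph:
  assumes "nonempty_digraph G" "inj_on f (pverts G)"
  shows "true_on A (map_digraph f G) \<longleftrightarrow> true_on A G"
proof
  assume L: "true_on A (map_digraph f G)"
  show "true_on A G"
    unfolding true_on_def
  proof (intro allI impI)
    fix \<nu> :: "nat \<Rightarrow> 'a" assume \<nu>: "range \<nu> \<subseteq> pverts G"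
    then have "range (f \<circ> \<nu>) \<subseteq> pverts (map_digraph f G)"
      by auto
    then show "sat G \<nu> A"
      using L sat_map_digraph[OF assms \<nu>] unfolding true_on_def by blast
  qed
next
  assume R: "true_on A G"
  show "true_on A (map_digraph f G)"
    unfolding true_on_def
  proof (intro allI impI)
    fix \<mu> :: "nat \<Rightarrow> 'b" assume \<mu>: "range \<mu> \<subseteq> pverts (map_digraph f G)"
    define \<nu> where "\<nu> = the_inv_into (pverts G) f \<circ> \<mu>"
    have \<nu>: "range \<nu> \<subseteq> pverts G"
      using \<mu> assms(2) by (auto simp: \<nu>_def intro!: the_inv_into_into)
    have "f \<circ> \<nu> = \<mu>"
      using \<mu> assms(2) by (auto simp: \<nu>_def fun_eq_iff f_the_inv_into_f image_subset_iff)
    then show "sat (map_digraph f G) \<mu> A"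
      using R sat_map_digraph[OF assms \<nu>, of A] \<nu> by (auto simp: true_on_def)
  qed
qed

lemma nonempty_digraph_nat_copy:
  assumes "nonempty_digraph (G :: 'a pair_pre_digraph)"
  obtains f :: "'a \<Rightarrow> nat" where "inj_on f (pverts G)" "nonempty_digraph (map_digraph f G)"
  using assms nonempty_digraph_map finite_imp_inj_to_nat_seg[of "pverts G"]
  by (metis nonempty_digraph_iff)

lemma equivalent_true_on:
  assumes "equivalent A B" "nonempty_digraph (G :: 'a pair_pre_digraph)"
  shows "true_on A G \<longleftrightarrow> true_on B G"
proof -
  obtain f :: "'a \<Rightarrow> nat" where f: "inj_on f (pverts G)" "nonempty_digraph (map_digraph f G)"
    using nonempty_digraph_nat_copy[OF assms(2)] .
  have "true_on A (map_digraph f G) \<longleftrightarrow> true_on B (map_digraph f G)"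
    using assms(1) f(2) by (auto simp: equivalent_def true_on_def)
  then show ?thesis
    using true_on_map_digraph[OF assms(2) f(1)] by simp
qed

lemma defines_digraph_equivalent:
  assumes "defines_digraph A G" "equivalent B A" "fv B = fv A" "nonempty_digraph G"
  shows "defines_digraph B G"
  using assms equivalent_true_on[OF assms(2), of G]
    equivalent_true_on[OF assms(2), where 'a = nat] by (auto simp: defines_digraph_def sentence_def)

text \<open>A relabelled copy of \<open>H\<close> on the natural numbers must be isomorphic to
  \<open>G\<close>. Vertex counts are the only invariant needed to refute definability
  below.\<close>

lemma defines_digraph_card:
  assumes "defines_digraph A G" "nonempty_digraph (H :: 'b pair_pre_digraph)" "true_on A H"
  shows "card (pverts H) = card (pverts G)"
proof -
  obtain f :: "'b \<Rightarrow> nat" where f: "inj_on f (pverts H)" "nonempty_digraph (map_digraph f H)"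
    using nonempty_digraph_nat_copy[OF assms(2)] .
  have "digraph_iso (with_proj G) (with_proj (map_digraph f H))"
    using assms f true_on_map_digraph[OF assms(2) f(1)] by (auto simp: defines_digraph_def)
  then obtain h where "pre_digraph.digraph_isomorphism (with_proj G) h"
    and "with_proj (map_digraph f H) = app_iso h (with_proj G)"
    by (auto simp: digraph_iso_def)
  then have "inj_on (iso_verts h) (pverts G)" "f ` pverts H = iso_verts h ` pverts G"
    by (auto simp: pre_digraph.digraph_isomorphism_def dest!: arg_cong[of _ _ verts])
  then show ?thesis
    using f(1) by (metis card_image)
qed

section \<open>Quantifier rank one\<close>

text \<open>A blow-up: every vertex becomes two twins, and twins are joined to each other exactly
  when the original vertex carries a loop.\<close>

definition double_digraph :: "'a pair_pre_digraph \<Rightarrow> ('a \<times> bool) pair_pre_digraph" where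
  "double_digraph G =
     \<lparr>pverts = pverts G \<times> UNIV, parcs = {(u, v). (fst u, fst v) \<in> parcs G}\<rparr>"

text \<open>With at most one free variable the atoms are \<open>EqF x x\<close> and
  \<open>ArcF x x\<close>, and a twin gives them the same value as its original.\<close>

lemma sat_double_digraph_qfree:
  assumes "qrank A = 0" "fv A \<subseteq> {x}" "fst (\<mu> x) = \<nu> x"
  shows "sat (double_digraph G) \<mu> A \<longleftrightarrow> sat G \<nu> A"
  using assms by (induction A) (auto simp: double_digraph_def)

text \<open>Such a sentence is a Boolean combination of formulas \<open>Qnt Q x A\<close> with
  \<open>A\<close> quantifier-free and at most \<open>x\<close> free, and the projection from the
  doubled vertices is onto.\<close>

lemma sat_double_digraph_rank1:
  assumes "qrank A \<le> 1" "fv A = {}"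
  shows "sat (double_digraph G) \<mu> A \<longleftrightarrow> sat G \<nu> A"
  using assms
proof (induction A)
  case (Qnt Q x A)
  then have "sat (double_digraph G) (\<mu>(x := p)) A \<longleftrightarrow> sat G (\<nu>(x := fst p)) A" for p
    by (intro sat_double_digraph_qfree[where x = x]) auto
  then show ?case
    by (cases Q) (auto simp: double_digraph_def)
qed auto

lemma defines_digraph_qrank_ge_2:
  assumes "defines_digraph A G" "nonempty_digraph G"
  shows "2 \<le> qrank A"
proof (rule ccontr)
  assume "\<not> 2 \<le> qrank A"
  then have "qrank A \<le> 1" "fv A = {}"
    using assms by (auto simp: defines_digraph_def sentence_def)
  note sat_eq = sat_double_digraph_rank1[OF this]
  obtain v where "v \<in> pverts G"
    using assms(2) by (auto simp: nonempty_digraph_iff)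
  then have "sat G (\<lambda>_. v) A"
    using assms(1) by (auto simp: defines_digraph_def true_on_def)
  then have "true_on A (double_digraph G)"
    using sat_eq by (auto simp: true_on_def)
  moreover have "nonempty_digraph (double_digraph G)"
    using assms(2) by (auto simp: nonempty_digraph_iff double_digraph_def)
  ultimately have "card (pverts (double_digraph G)) = card (pverts G)"
    using defines_digraph_card assms(1) by blast
  then show False
    using assms(2) by (simp add: double_digraph_def nonempty_digraph_iff card_cartesian_product)
qed

section \<open>Iterated connectives\<close>

fun join_list :: "(fm \<Rightarrow> fm \<Rightarrow> fm) \<Rightarrow> fm list \<Rightarrow> fm" where
  "join_list c [] = undefined"
| "join_list c [A] = A"
| "join_list c (A # B # As) = c A (join_list c (B # As))"

text \<open>The listing is chosen from the set alone, so the formula is a function of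
  \<open>X\<close>. Counting formulas thus reduces to counting sets.\<close>

definition join :: "(fm \<Rightarrow> fm \<Rightarrow> fm) \<Rightarrow> fm set \<Rightarrow> fm" where
  "join c X = join_list c (SOME As. distinct As \<and> set As = X)"

lemma join_cases:
  assumes "finite X" "X \<noteq> {}"
  obtains As where "join c X = join_list c As" "distinct As" "set As = X" "As \<noteq> []"
proof -
  have "\<exists>As. distinct As \<and> set As = X"
    using finite_distinct_list[OF assms(1)] by blast
  from someI_ex[OF this] show thesis
    using assms(2) by (intro that[of "SOME As. distinct As \<and> set As = X"]) (auto simp: join_def)
qed

lemma join_list_induct [consumes 1, case_names single cons]:
  fixes As :: "fm list"
  assumes "As \<noteq> []" "\<And>A. P [A]" "\<And>A B As. P (B # As) \<Longrightarrow> P (A # B # As)"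
  shows "P As"
  using assms(1) by (induction As rule: join_list.induct) (use assms(2,3) in auto)

lemma sat_join_Con:
  assumes "finite X" "X \<noteq> {}"
  shows "sat G \<nu> (join Con X) \<longleftrightarrow> (\<forall>A\<in>X. sat G \<nu> A)"
proof -
  have "sat G \<nu> (join_list Con As) \<longleftrightarrow> (\<forall>A\<in>set As. sat G \<nu> A)" if "As \<noteq> []" for As
    using that by (induction As rule: join_list_induct) auto
  then show ?thesis
    using join_cases[OF assms] by metis
qed

lemma sat_join_Dis:
  assumes "finite X" "X \<noteq> {}"
  shows "sat G \<nu> (join Dis X) \<longleftrightarrow> (\<exists>A\<in>X. sat G \<nu> A)"
proof -
  have "sat G \<nu> (join_list Dis As) \<longleftrightarrow> (\<exists>A\<in>set As. sat G \<nu> A)" if "As \<noteq> []" for As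
    using that by (induction As rule: join_list_induct) auto
  then show ?thesis
    using join_cases[OF assms] by metis
qed

lemma join_induct [consumes 3, case_names base step]:
  assumes "finite X" "X \<noteq> {}" "c = Con \<or> c = Dis"
    and "\<And>A. A \<in> X \<Longrightarrow> P A"
    and "\<And>A B. P A \<Longrightarrow> P B \<Longrightarrow> P (c A B)"
  shows "P (join c X)"
proof -
  have "P (join_list c As)" if "As \<noteq> []" "set As \<subseteq> X" for As
    using that by (induction As rule: join_list_induct) (use assms(4,5) in auto)
  then show ?thesis
    using join_cases[OF assms(1,2)] by (metis subset_refl)
qed

section \<open>Symbol counts of iterated connectives\<close>

lemma fm_length_simps [simp]:
  "fm_length (EqF x y) = 3"
  "fm_length (ArcF x y) = 3"
  "fm_length (Neg A) = fm_length A + 1"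
  "fm_length (Con A B) = fm_length A + fm_length B + 3"
  "fm_length (Dis A B) = fm_length A + fm_length B + 3"
  "fm_length (Qnt Q x A) = fm_length A + 2"
  by (simp_all add: fm_length_def)

text \<open>A connective with its parentheses costs 3 symbols and there is one fewer of them than
  members; the added 3 on the left evens this out to \<open>l + 3\<close> per member.\<close>

lemma fm_length_join:
  assumes "finite X" "X \<noteq> {}" "c = Con \<or> c = Dis" "\<And>A. A \<in> X \<Longrightarrow> fm_length A \<le> l"
  shows "fm_length (join c X) + 3 \<le> card X * (l + 3)"
proof -
  have "fm_length (join_list c As) + 3 \<le> length As * (l + 3)" if "As \<noteq> []" "set As \<subseteq> X" for As
    using that
  proof (induction As rule: join_list_induct)
    case (cons A B As)
    have "fm_length A \<le> l"
      using cons.prems assms(4) by auto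
    then show ?case
      using assms(3) cons by auto
  qed (use assms(4) in auto)
  then show ?thesis
    using join_cases[OF assms(1,2)] by (metis distinct_card subset_refl)
qed

section \<open>Characteristic formulas\<close>

definition atoms :: "var list \<Rightarrow> fm set" where
  "atoms xs = case_prod EqF ` (set xs \<times> set xs) \<union> case_prod ArcF ` (set xs \<times> set xs)"

text \<open>If \<open>T\<close> consists of the atoms in \<open>At\<close> that are true, this is
  the atomic diagram: it fixes every atom in both directions.\<close>

definition literals :: "fm set \<Rightarrow> fm set \<Rightarrow> fm set" where
  "literals At T = (\<lambda>A. if A \<in> T then A else Neg A) ` At"

text \<open>The left quotient of the language \<open>S\<close> by the letter
  \<open>Q\<close>.\<close>

definition continuations :: "quant \<Rightarrow> quant list set \<Rightarrow> quant list set" where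
  "continuations Q S = {w. Q # w \<in> S}"

text \<open>\<open>E\<close> says that every type in \<open>X\<close> is realised, \<open>U\<close>
  that no type outside \<open>Y\<close> is. A half whose quantifier starts no word of
  \<open>S\<close> is dropped, so that no foreign word arises.\<close>

definition quant_step :: "var \<Rightarrow> quant list set \<Rightarrow> fm set \<Rightarrow> fm set \<Rightarrow> fm" where
  "quant_step y S X Y =
     (let E = join Con (Qnt Ex_Q y ` X); U = Qnt All_Q y (join Dis Y) in
      if continuations All_Q S = {} then E
      else if continuations Ex_Q S = {} then U
      else Con E U)"

text \<open>
  The strongest condition on \<open>(G, \<nu>)\<close> expressible by quantifying the variables \<open>ys\<close> in this order
  with quantifier words from \<open>S\<close>. Atoms are tested only innermost, which loses nothing because
  all words have the same length.
\<close>

fun char_fm :: "var list \<Rightarrow> var list \<Rightarrow> quant list set \<Rightarrow> 'a pair_pre_digraph \<Rightarrow> (var \<Rightarrow> 'a) \<Rightarrow> fm"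
where
  "char_fm xs [] S G \<nu> = join Con (literals (atoms xs) {A \<in> atoms xs. sat G \<nu> A})"
| "char_fm xs (y # ys) S G \<nu> =
     quant_step y S ((\<lambda>v. char_fm xs ys (continuations Ex_Q S) G (\<nu>(y := v))) ` pverts G)
                    ((\<lambda>v. char_fm xs ys (continuations All_Q S) G (\<nu>(y := v))) ` pverts G)"

lemma finite_atoms: "finite (atoms xs)"
  by (simp add: atoms_def)

lemma finite_literals: "finite At \<Longrightarrow> finite (literals At T)"
  by (simp add: literals_def)

lemma literals_atoms_nonempty: "xs \<noteq> [] \<Longrightarrow> literals (atoms xs) T \<noteq> {}"
  unfolding literals_def image_is_empty by (simp add: atoms_def)

lemma length_continuations:
  assumes "w \<in> continuations Q S" "\<And>w. w \<in> S \<Longrightarrow> length w = Suc n"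
  shows "length w = n"
  using assms(2)[of "Q # w"] assms(1) by (simp add: continuations_def)

lemma words_cases:
  assumes "S \<noteq> {}" "\<And>w. w \<in> S \<Longrightarrow> length w = Suc n"
  obtains "continuations Ex_Q S \<noteq> {}" | "continuations All_Q S \<noteq> {}"
proof -
  obtain w where "w \<in> S"
    using assms(1) by blast
  with assms(2) obtain Q u where "Q # u \<in> S"
    by (metis length_Suc_conv)
  then show thesis
    using that by (cases Q) (auto simp: continuations_def)
qed

lemma sat_quant_step:
  assumes "finite X" "X \<noteq> {}" "finite Y" "Y \<noteq> {}"
    and "S \<noteq> {}" "\<And>w. w \<in> S \<Longrightarrow> length w = Suc n"
  shows "sat H \<mu> (quant_step y S X Y) \<longleftrightarrow>
    (continuations Ex_Q S \<noteq> {} \<longrightarrow> (\<forall>A\<in>X. \<exists>w\<in>pverts H. sat H (\<mu>(y := w)) A)) \<and>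
    (continuations All_Q S \<noteq> {} \<longrightarrow> (\<forall>w\<in>pverts H. \<exists>A\<in>Y. sat H (\<mu>(y := w)) A))"
  using words_cases[OF assms(5,6)] assms(1-4)
  by (auto simp: quant_step_def Let_def sat_join_Con sat_join_Dis)

text \<open>One round of an Ehrenfeucht-Fraisse game in which Spoiler spells a word of
  \<open>S\<close>: for \<open>Ex_Q\<close> he moves in \<open>G\<close>, for \<open>All_Q\<close>
  in \<open>H\<close>, and Duplicator answers in the other digraph.\<close>

lemma sat_char_fm_Cons:
  assumes "finite (pverts G)" "pverts G \<noteq> {}"
    and "S \<noteq> {}" "\<And>w. w \<in> S \<Longrightarrow> length w = Suc n"
  shows "sat H \<mu> (char_fm xs (y # ys) S G \<nu>) \<longleftrightarrow>
    (continuations Ex_Q S \<noteq> {} \<longrightarrow> (\<forall>v\<in>pverts G. \<exists>w\<in>pverts H.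
      sat H (\<mu>(y := w)) (char_fm xs ys (continuations Ex_Q S) G (\<nu>(y := v))))) \<and>
    (continuations All_Q S \<noteq> {} \<longrightarrow> (\<forall>w\<in>pverts H. \<exists>v\<in>pverts G.
      sat H (\<mu>(y := w)) (char_fm xs ys (continuations All_Q S) G (\<nu>(y := v)))))"
  unfolding char_fm.simps
  by (subst sat_quant_step[OF _ _ _ _ assms(3,4)]) (simp_all add: assms(1,2))

lemma quant_step_induct:
  assumes "finite X" "X \<noteq> {}" "finite Y" "Y \<noteq> {}"
    and "S \<noteq> {}" "\<And>w. w \<in> S \<Longrightarrow> length w = Suc n"
    and ex: "\<And>A. continuations Ex_Q S \<noteq> {} \<Longrightarrow> A \<in> X \<Longrightarrow> P (Qnt Ex_Q y A)"
    and all: "continuations All_Q S \<noteq> {} \<Longrightarrow> P (Qnt All_Q y (join Dis Y))"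
    and con: "\<And>A B. P A \<Longrightarrow> P B \<Longrightarrow> P (Con A B)"
  shows "P (quant_step y S X Y)"
proof -
  have "P (join Con (Qnt Ex_Q y ` X))" if "continuations Ex_Q S \<noteq> {}"
    by (rule join_induct) (use assms that in auto)
  then show ?thesis
    using words_cases[OF assms(5,6)] all con
    by (auto simp: quant_step_def Let_def)
qed

section \<open>Characteristic formulas are true and strongest\<close>

text \<open>Duplicator copies each move. The assignments may differ on \<open>ys\<close>, as these
  variables get reassigned.\<close>

lemma sat_char_fm_self:
  assumes "finite (pverts G)" "pverts G \<noteq> {}" "xs \<noteq> []"
    and "S \<noteq> {}" "\<And>w. w \<in> S \<Longrightarrow> length w = length ys"
    and "\<And>x. x \<in> set xs - set ys \<Longrightarrow> \<mu> x = \<nu> x"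
  shows "sat G \<mu> (char_fm xs ys S G \<nu>)"
  using assms(4-6)
proof (induction ys arbitrary: S \<mu> \<nu>)
  case Nil
  then have "sat G \<mu> A \<longleftrightarrow> sat G \<nu> A" if "A \<in> atoms xs" for A
    using that by (auto simp: atoms_def)
  then show ?case
    using assms(3) by (auto simp: sat_join_Con finite_literals finite_atoms
      literals_atoms_nonempty) (auto simp: literals_def)
next
  case (Cons y ys)
  have "sat G (\<mu>(y := v)) (char_fm xs ys (continuations Q S) G (\<nu>(y := v)))"
    if "continuations Q S \<noteq> {}" for v Q
    by (rule Cons.IH) (use that Cons.prems length_continuations[of _ Q S "length ys"] in auto)
  moreover have "\<And>w. w \<in> S \<Longrightarrow> length w = Suc (length ys)"
    using Cons.prems(2) by simp
  note sat_char_fm_Cons[OF assms(1,2) Cons.prems(1) this]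
  ultimately show ?case
    by blast
qed

text \<open>Although atoms are tested only innermost, some play reaches that level, and its moves
  change only variables not occurring in \<open>A\<close>.\<close>

lemma char_fm_atom_agree:
  assumes "finite (pverts G)" "pverts G \<noteq> {}" "pverts H \<noteq> {}"
    and "S \<noteq> {}" "\<And>w. w \<in> S \<Longrightarrow> length w = length ys"
    and "sat H \<mu> (char_fm xs ys S G \<nu>)"
    and "A \<in> atoms xs" "fv A \<inter> set ys = {}"
  shows "sat H \<mu> A \<longleftrightarrow> sat G \<nu> A"
  using assms(4-6,8)
proof (induction ys arbitrary: S \<mu> \<nu>)
  case Nil
  have "xs \<noteq> []"
    using assms(7) by (auto simp: atoms_def)
  then have "\<forall>B\<in>literals (atoms xs) {A \<in> atoms xs. sat G \<nu> A}. sat H \<mu> B"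
    using Nil.prems(3) by (simp add: sat_join_Con finite_literals finite_atoms
      literals_atoms_nonempty)
  then have "sat H \<mu> (if A \<in> {A \<in> atoms xs. sat G \<nu> A} then A else Neg A)"
    using assms(7) unfolding literals_def by blast
  then show ?case
    using assms(7) by (auto split: if_splits)
next
  case (Cons y ys)
  \<comment> \<open>Any first letter of a word in \<open>S\<close> will do; as both vertex sets are
    nonempty, there is a move and an answer to it.\<close>
  obtain Q v w where Q: "continuations Q S \<noteq> {}"
    and vw: "sat H (\<mu>(y := w)) (char_fm xs ys (continuations Q S) G (\<nu>(y := v)))"
  proof -
    have len: "\<And>w. w \<in> S \<Longrightarrow> length w = Suc (length ys)"
      using Cons.prems(2) by simp
    note sat = iffD1[OF sat_char_fm_Cons[OF assms(1,2) Cons.prems(1) len] Cons.prems(3)]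
    show thesis
      by (rule words_cases[OF Cons.prems(1) len]) (use sat assms(2,3) that in blast)+
  qed
  have "sat H (\<mu>(y := w)) A \<longleftrightarrow> sat G (\<nu>(y := v)) A"
    by (rule Cons.IH[OF Q _ vw])
      (use Cons.prems(2,4) length_continuations[of _ Q S "length ys"] in auto)
  moreover have "sat K (\<kappa>(y := u)) A \<longleftrightarrow> sat K \<kappa> A" for K :: "'c pair_pre_digraph" and \<kappa> u
    using assms(7) Cons.prems(4) by (auto simp: atoms_def)
  moreover have "sat K (\<kappa>(y := u)) A \<longleftrightarrow> sat K \<kappa> A" for K :: "'d pair_pre_digraph" and \<kappa> u
    using assms(7) Cons.prems(4) by (auto simp: atoms_def)
  ultimately show ?case
    using assms(7) Cons.prems(4) by (auto simp: atoms_def)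
qed

text \<open>Induction on \<open>B\<close>: negations sit at atoms only, so truth needs to pass just
  from \<open>G\<close> to \<open>H\<close>. Atoms may occur beside quantified subformulas, hence
  before \<open>ys\<close> is used up; \<open>char_fm_atom_agree\<close> covers them there
  too.\<close>

lemma char_fm_strongest:
  assumes "finite (pverts G)" "pverts G \<noteq> {}" "pverts H \<noteq> {}"
    and "S \<noteq> {}" "\<And>w. w \<in> S \<Longrightarrow> length w = length ys"
    and "sat H \<mu> (char_fm xs ys S G \<nu>)"
    and "distinct ys" "set ys \<subseteq> set xs" "fv B \<subseteq> set xs - set ys" "neg_atoms_only B"
    and "\<And>q. q \<in> nested_quants B \<Longrightarrow> map snd q = ys \<and> map fst q \<in> S"
    and "sat G \<nu> B"
  shows "sat H \<mu> B"
  using assms(4-)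
proof (induction B arbitrary: S ys \<mu> \<nu>)
  case (EqF x y)
  have "sat H \<mu> (EqF x y) \<longleftrightarrow> sat G \<nu> (EqF x y)"
    by (rule char_fm_atom_agree[OF assms(1-3) EqF(1,2,3)]) (use EqF in \<open>auto simp: atoms_def\<close>)
  with EqF show ?case by blast
next
  case (ArcF x y)
  have "sat H \<mu> (ArcF x y) \<longleftrightarrow> sat G \<nu> (ArcF x y)"
    by (rule char_fm_atom_agree[OF assms(1-3) ArcF(1,2,3)]) (use ArcF in \<open>auto simp: atoms_def\<close>)
  with ArcF show ?case by blast
next
  case (Neg A)
  have "sat H \<mu> A \<longleftrightarrow> sat G \<nu> A"
    by (rule char_fm_atom_agree[OF assms(1-3) Neg.prems(1,2,3)])
      (use Neg.prems in \<open>cases A; auto simp: atoms_def\<close>)+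
  with Neg.prems show ?case by simp
next
  case (Con A B)
  have "sat H \<mu> A"
    by (rule Con.IH(1)[OF Con.prems(1-5)]) (use Con.prems in auto)
  moreover have "sat H \<mu> B"
    by (rule Con.IH(2)[OF Con.prems(1-5)]) (use Con.prems in auto)
  ultimately show ?case by simp
next
  case (Dis A B)
  from Dis.prems(9) consider "sat G \<nu> A" | "sat G \<nu> B" by auto
  then show ?case
  proof cases
    case 1
    have "sat H \<mu> A"
      by (rule Dis.IH(1)[OF Dis.prems(1-5)]) (use Dis.prems 1 in auto)
    then show ?thesis by simp
  next
    case 2
    have "sat H \<mu> B"
      by (rule Dis.IH(2)[OF Dis.prems(1-5)]) (use Dis.prems 2 in auto)
    then show ?thesis by simp
  qed
next
  case (Qnt Q x A)
  \<comment> \<open>Any nested sequence shows that \<open>x\<close> heads \<open>ys\<close> and that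
    \<open>Q\<close> starts a word of \<open>S\<close>.\<close>
  have "\<exists>q. q \<in> nested_quants (Qnt Q x A)"
    by auto
  then obtain q where q: "q \<in> nested_quants (Qnt Q x A)" ..
  obtain zs where ys: "ys = x # zs"
    using Qnt.prems(8)[OF q] q by (auto split: if_splits)
  have "Q # tl (map fst q) \<in> S"
    using Qnt.prems(8)[OF q] q by (auto split: if_splits)
  then have cont: "continuations Q S \<noteq> {}"
    by (auto simp: continuations_def)
  have len: "length w = length zs" if "w \<in> continuations Q S" for w
    by (rule length_continuations[OF that]) (use Qnt.prems(2) ys in simp)
  have nq: "map snd p = zs \<and> map fst p \<in> continuations Q S" if "p \<in> nested_quants A" for p
  proof -
    have "(Q, x) # p \<in> nested_quants (Qnt Q x A)"
      using that by auto
    from Qnt.prems(8)[OF this] show ?thesis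
      using ys by (simp add: continuations_def)
  qed
  have fv_A: "fv A \<subseteq> set xs - set zs"
    using Qnt.prems(4-6) ys by auto
  have step: "sat H (\<mu>(x := w)) A"
    if "sat H (\<mu>(x := w)) (char_fm xs zs (continuations Q S) G (\<nu>(x := v)))"
      and "sat G (\<nu>(x := v)) A" for v w
    by (rule Qnt.IH[OF cont len that(1) _ _ fv_A _ nq that(2)]) (use Qnt.prems(4,5,7) ys in auto)
  have "\<And>w. w \<in> S \<Longrightarrow> length w = Suc (length zs)"
    using Qnt.prems(2) ys by simp
  note sat = iffD1[OF sat_char_fm_Cons[OF assms(1,2) Qnt.prems(1) this] Qnt.prems(3)[unfolded ys]]
  \<comment> \<open>For \<open>All_Q\<close> a vertex of \<open>H\<close> is answered in
    \<open>G\<close>; for \<open>Ex_Q\<close> the witness in \<open>G\<close> is answered in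
    \<open>H\<close>.\<close>
  show ?case
  proof (cases Q)
    case All_Q
    then show ?thesis
      using sat cont step Qnt.prems(9) by simp metis
  next
    case Ex_Q
    then show ?thesis
      using sat cont step Qnt.prems(9) by simp metis
  qed
qed

section \<open>Normality of characteristic formulas\<close>

text \<open>The inductive form of \<open>normal_wrt\<close>, for a subformula in which
  \<open>ys\<close> is still to be quantified. The emptiness clause tells whether a further
  quantifier starts a sequence or extends existing ones.\<close>

definition normal_matrix :: "var list \<Rightarrow> var list \<Rightarrow> quant list set \<Rightarrow> fm \<Rightarrow> bool" where
  "normal_matrix xs ys S A \<longleftrightarrow>
     fv A \<subseteq> set xs - set ys \<and> qrank A = length ys \<and> neg_atoms_only A \<and> vars A \<subseteq> set xs \<and>
     (nested_quants A = {} \<longleftrightarrow> ys = []) \<and>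
     (\<forall>q \<in> nested_quants A. map snd q = ys \<and> map fst q \<in> S)"

lemma normal_matrix_Con:
  "normal_matrix xs ys S A \<Longrightarrow> normal_matrix xs ys S B \<Longrightarrow> normal_matrix xs ys S (Con A B)"
  and normal_matrix_Dis:
  "normal_matrix xs ys S A \<Longrightarrow> normal_matrix xs ys S B \<Longrightarrow> normal_matrix xs ys S (Dis A B)"
  by (auto simp: normal_matrix_def)

lemma normal_matrix_Qnt:
  assumes "normal_matrix xs ys (continuations Q S) A" "y \<in> set xs"
    and "continuations Q S \<noteq> {}" "\<And>w. w \<in> S \<Longrightarrow> length w = Suc (length ys)"
  shows "normal_matrix xs (y # ys) S (Qnt Q y A)"
proof -
  \<comment> \<open>Innermost, the new sequence consists of \<open>Q\<close> alone, and the only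
    word available in the quotient is the empty one.\<close>
  have "[Q] \<in> S" if "ys = []"
    using assms(3) length_continuations[OF _ assms(4)] that
    by (auto simp: continuations_def)
  then show ?thesis
    using assms(1,2) by (auto simp: normal_matrix_def continuations_def split: if_splits)
qed

lemma normal_matrix_char_fm:
  assumes "finite (pverts G)" "pverts G \<noteq> {}" "xs \<noteq> []"
    and "S \<noteq> {}" "\<And>w. w \<in> S \<Longrightarrow> length w = length ys" "set ys \<subseteq> set xs"
  shows "normal_matrix xs ys S (char_fm xs ys S G \<nu>)"
  using assms(4-6)
proof (induction ys arbitrary: S \<nu>)
  case Nil
  have lit: "normal_matrix xs [] S A" if "A \<in> literals (atoms xs) T" for A T
    using that by (auto simp: literals_def atoms_def normal_matrix_def split: if_splits)
  show ?case
    unfolding char_fm.simps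
    by (rule join_induct[OF finite_literals[OF finite_atoms] literals_atoms_nonempty[OF assms(3)]])
      (auto intro: lit normal_matrix_Con)
next
  case (Cons y ys)
  have sub: "normal_matrix xs ys (continuations Q S) (char_fm xs ys (continuations Q S) G \<nu>')"
    if "continuations Q S \<noteq> {}" for \<nu>' Q
    by (rule Cons.IH) (use that Cons.prems length_continuations[of _ Q S "length ys"] in auto)
  have dis: "normal_matrix xs ys (continuations All_Q S)
      (join Dis ((\<lambda>v. char_fm xs ys (continuations All_Q S) G (\<nu>(y := v))) ` pverts G))"
    if "continuations All_Q S \<noteq> {}"
    by (rule join_induct) (use assms(1,2) sub[OF that] normal_matrix_Dis in auto)
  have len: "\<And>w. w \<in> S \<Longrightarrow> length w = Suc (length ys)"
    using Cons.prems(2) by simp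
  have y: "y \<in> set xs"
    using Cons.prems(3) by simp
  show ?case
    unfolding char_fm.simps
  proof (rule quant_step_induct[OF _ _ _ _ Cons.prems(1) len])
    fix A assume ex: "continuations Ex_Q S \<noteq> {}"
      and "A \<in> (\<lambda>v. char_fm xs ys (continuations Ex_Q S) G (\<nu>(y := v))) ` pverts G"
    then have "normal_matrix xs ys (continuations Ex_Q S) A"
      using sub by blast
    then show "normal_matrix xs (y # ys) S (Qnt Ex_Q y A)"
      using y ex len by (rule normal_matrix_Qnt)
  next
    assume all: "continuations All_Q S \<noteq> {}"
    from dis[OF all] y all len
    show "normal_matrix xs (y # ys) S (Qnt All_Q y
        (join Dis ((\<lambda>v. char_fm xs ys (continuations All_Q S) G (\<nu>(y := v))) ` pverts G)))"
      by (rule normal_matrix_Qnt)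
  qed (use assms(1,2) normal_matrix_Con in auto)
qed

section \<open>Length of characteristic formulas\<close>

text \<open>Innermost, a formula is given by the truth values of at most
  \<open>2 * k\<^sup>2\<close> atoms; further out by two sets of formulas of the previous level,
  whence \<open>2 ^ t * 2 ^ t = 4 ^ t\<close>.\<close>

primrec type_bound :: "nat \<Rightarrow> nat \<Rightarrow> nat" where
  "type_bound k 0 = 2 ^ (2 * k\<^sup>2)"
| "type_bound k (Suc n) = 4 ^ type_bound k n"

text \<open>A literal has at most 4 symbols plus 3 for joining, so \<open>2 * k\<^sup>2\<close> of
  them give 14. In the recursion 5 is 2 for the quantifier plus 3 for joining, and the factor 2
  stands for the two halves of \<open>quant_step\<close>.\<close>

primrec length_bound :: "nat \<Rightarrow> nat \<Rightarrow> nat" where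
  "length_bound k 0 = 14 * k\<^sup>2"
| "length_bound k (Suc n) = 2 * type_bound k n * (length_bound k n + 5)"

lemma card_atoms: "card (atoms xs) \<le> 2 * (length xs)\<^sup>2"
proof -
  have "card (set xs \<times> set xs) \<le> (length xs)\<^sup>2"
    by (simp add: card_cartesian_product power2_eq_square card_length mult_le_mono)
  moreover have "card (atoms xs) \<le> card (set xs \<times> set xs) + card (set xs \<times> set xs)"
    unfolding atoms_def by (intro order_trans[OF card_Un_le] add_mono card_image_le) auto
  ultimately show ?thesis by simp
qed

text \<open>With \<open>G\<close> and \<open>S\<close> fixed, the assignment enters only through the
  two sets of inner formulas. The resulting bound is independent of the size of
  \<open>G\<close>.\<close>

lemma char_fm_count:
  assumes "finite (pverts G)"
  shows "finite (range (char_fm xs ys S G)) \<and>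
    card (range (char_fm xs ys S G)) \<le> type_bound (length xs) (length ys)"
proof (induction ys arbitrary: S)
  case Nil
  let ?f = "\<lambda>T. join Con (literals (atoms xs) T)"
  have sub: "range (char_fm xs [] S G) \<subseteq> ?f ` Pow (atoms xs)"
    by auto
  have fin: "finite (?f ` Pow (atoms xs))"
    by (simp add: finite_atoms)
  have "card (?f ` Pow (atoms xs)) \<le> 2 ^ card (atoms xs)"
    using card_image_le[of "Pow (atoms xs)" ?f] by (simp add: finite_atoms card_Pow)
  also have "\<dots> \<le> 2 ^ (2 * (length xs)\<^sup>2)"
    using card_atoms by (intro power_increasing) auto
  finally show ?case
    using card_mono[OF fin sub] finite_subset[OF sub fin] by simp
next
  case (Cons y ys)
  define R where "R Q = range (char_fm xs ys (continuations Q S) G)" for Q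
  let ?t = "type_bound (length xs) (length ys)"
  let ?D = "Pow (R Ex_Q) \<times> Pow (R All_Q)"
  have R: "finite (R Q)" "card (R Q) \<le> ?t" for Q
    using Cons.IH by (auto simp: R_def)
  have sub: "range (char_fm xs (y # ys) S G) \<subseteq> case_prod (quant_step y S) ` ?D"
  proof
    fix A assume "A \<in> range (char_fm xs (y # ys) S G)"
    then obtain \<nu> where "A = char_fm xs (y # ys) S G \<nu>" by blast
    then show "A \<in> case_prod (quant_step y S) ` ?D"
      by (intro image_eqI[where x = "((\<lambda>v. char_fm xs ys (continuations Ex_Q S) G (\<nu>(y := v))) ` pverts G,
        (\<lambda>v. char_fm xs ys (continuations All_Q S) G (\<nu>(y := v))) ` pverts G)"])
        (auto simp: R_def)
  qed
  have fin: "finite (case_prod (quant_step y S) ` ?D)"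
    using R by simp
  have "card (case_prod (quant_step y S) ` ?D) \<le> card ?D"
    using R by (intro card_image_le) simp
  also have "\<dots> = 2 ^ card (R Ex_Q) * 2 ^ card (R All_Q)"
    using R by (simp add: card_cartesian_product card_Pow)
  also have "\<dots> \<le> 2 ^ ?t * 2 ^ ?t"
    using R by (intro mult_le_mono power_increasing) auto
  also have "\<dots> = 4 ^ ?t"
    by (simp flip: power_mult_distrib)
  finally show ?case
    using card_mono[OF fin sub] finite_subset[OF sub fin] by simp
qed

lemma fm_length_quant_step:
  assumes "finite X" "X \<noteq> {}" "finite Y" "Y \<noteq> {}" "card X \<le> t" "card Y \<le> t"
    and "\<And>A. A \<in> X \<union> Y \<Longrightarrow> fm_length A \<le> l"
  shows "fm_length (quant_step y S X Y) \<le> 2 * t * (l + 5)"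
proof -
  have "fm_length (join Con (Qnt Ex_Q y ` X)) + 3 \<le> card (Qnt Ex_Q y ` X) * (l + 2 + 3)"
    using assms by (intro fm_length_join) auto
  also have "\<dots> \<le> t * (l + 5)"
    using assms card_image_le[of X "Qnt Ex_Q y"] by (intro mult_le_mono) auto
  finally have E: "fm_length (join Con (Qnt Ex_Q y ` X)) + 3 \<le> t * (l + 5)" .
  have "fm_length (join Dis Y) + 3 \<le> card Y * (l + 3)"
    using assms by (intro fm_length_join) auto
  also have "\<dots> \<le> t * (l + 5)"
    using assms by (intro mult_le_mono) auto
  \<comment> \<open>The two surpluses of 3 pay for the quantifier of \<open>U\<close> (2 symbols)
    and the outer conjunction (3 symbols).\<close>
  finally show ?thesis
    using E by (simp add: quant_step_def Let_def)
qed

lemma fm_length_char_fm: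
  assumes "finite (pverts G)" "pverts G \<noteq> {}" "xs \<noteq> []"
  shows "fm_length (char_fm xs ys S G \<nu>) \<le> length_bound (length xs) (length ys)"
proof (induction ys arbitrary: S \<nu>)
  case Nil
  let ?L = "literals (atoms xs) {A \<in> atoms xs. sat G \<nu> A}"
  have "fm_length (join Con ?L) + 3 \<le> card ?L * (4 + 3)"
    using assms(3) by (intro fm_length_join)
      (auto simp: finite_literals finite_atoms literals_atoms_nonempty,
       auto simp: literals_def atoms_def)
  moreover have "card ?L \<le> 2 * (length xs)\<^sup>2"
    using card_atoms[of xs] card_image_le[OF finite_atoms[of xs]]
    unfolding literals_def by (meson order_trans)
  ultimately show ?case by simp
next
  case (Cons y ys)
  let ?X = "\<lambda>Q. (\<lambda>v. char_fm xs ys (continuations Q S) G (\<nu>(y := v))) ` pverts G"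
  \<comment> \<open>Vertices with the same inner formula contribute one member, so the number of
    types bounds the join, however large \<open>G\<close> is.\<close>
  have card: "card (?X Q) \<le> type_bound (length xs) (length ys)" for Q
  proof -
    have "card (?X Q) \<le> card (range (char_fm xs ys (continuations Q S) G))"
      using char_fm_count[OF assms(1)] by (intro card_mono) auto
    then show ?thesis
      using char_fm_count[OF assms(1)] by (meson order_trans)
  qed
  have "fm_length (quant_step y S (?X Ex_Q) (?X All_Q)) \<le>
      2 * type_bound (length xs) (length ys) * (length_bound (length xs) (length ys) + 5)"
    by (rule fm_length_quant_step) (use assms(1,2) card Cons.IH in auto)
  then show ?case by simp
qed

section \<open>Towers\<close>

abbreviation iter_exp :: "nat \<Rightarrow> nat \<Rightarrow> nat" where
  "iter_exp n \<equiv> (\<lambda>m. 2 ^ m) ^^ n"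

lemma iter_exp_strict_mono: "a < b \<Longrightarrow> iter_exp n a < iter_exp n b"
  by (induction n) auto

lemma iter_exp_ge: "a \<le> iter_exp n a"
proof (induction n)
  case (Suc n)
  then show ?case
    using less_exp[of "iter_exp n a"] by (simp del: less_exp)
qed simp

lemma tower_add: "tower (n + m) = iter_exp n (tower m)"
  by (induction n) auto

lemma less_tower: "n < tower n"
proof (induction n)
  case (Suc n)
  then show ?case
    using less_exp[of "tower n"] by (simp del: less_exp)
qed simp

section \<open>Iterated logarithms against towers\<close>

lemma iter_log_le_1_imp_le_tower: "(log 2 ^^ i) x \<le> 1 \<Longrightarrow> x \<le> real (tower i)"
proof (induction i arbitrary: x)
  case (Suc i)
  then have "log 2 x \<le> real (tower i)"
    by (simp add: funpow_swap1)
  \<comment> \<open>For x \<le> 0 the logarithm tells nothing, but the bound holds because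
    \<open>tower\<close> is nonnegative.\<close>
  show ?case
  proof (cases "x > 0")
    case True
    then have "x \<le> 2 powr real (tower i)"
      using \<open>log 2 x \<le> real (tower i)\<close> by (simp add: log_le_iff)
    then show ?thesis
      by (simp add: powr_realpow)
  qed (simp add: order_trans[of x 0])
qed simp

text \<open>Ensures that the minimum in \<open>log_star\<close> is attained. The iteration stops as
  soon as the value is at most 1, possibly before \<open>i\<close> rounds.\<close>

lemma le_tower_imp_iter_log_le_1: "x \<le> real (tower i) \<Longrightarrow> \<exists>j. (log 2 ^^ j) x \<le> 1"
proof (induction i arbitrary: x)
  case 0
  then show ?case by (intro exI[of _ 0]) simp
next
  case (Suc i)
  show ?case
  proof (cases "x \<le> 1")
    case True
    then show ?thesis by (intro exI[of _ 0]) simp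
  next
    case False
    then have "log 2 x \<le> real (tower i)"
      using Suc.prems by (simp add: log_le_iff powr_realpow)
    then obtain j where "(log 2 ^^ j) (log 2 x) \<le> 1"
      using Suc.IH by blast
    then show ?thesis
      by (intro exI[of _ "Suc j"]) (simp add: funpow_swap1)
  qed
qed

lemma le_tower_log_star: "n \<le> tower (log_star n)"
proof -
  have "\<exists>j. (log 2 ^^ j) (real n) \<le> 1"
    using le_tower_imp_iter_log_le_1[of "real n" n] less_tower[of n] by simp
  then have "(log 2 ^^ log_star n) (real n) \<le> 1"
    unfolding log_star_def by (rule LeastI_ex)
  from iter_log_le_1_imp_le_tower[OF this] show ?thesis by simp
qed

section \<open>Growth of the type and length bounds\<close>

text \<open>Bounding \<open>2 * t + 2\<close> instead of \<open>t\<close> lets the induction close: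
  \<open>2 * 4 ^ t + 2\<close> is at most \<open>2 ^ (2 * t + 2)\<close>.\<close>

lemma type_bound_le: "2 * type_bound k n + 2 \<le> iter_exp (Suc n) (2 * k\<^sup>2 + 2)"
proof (induction n)
  case 0
  show ?case
    by simp
next
  case (Suc n)
  let ?t = "type_bound k n"
  have "2 * 4 ^ ?t + 2 \<le> (2 :: nat) ^ (2 * ?t + 2)"
    by (simp add: power_mult)
  also have "\<dots> \<le> 2 ^ iter_exp (Suc n) (2 * k\<^sup>2 + 2)"
    using Suc.IH by (intro power_increasing) auto
  finally show ?case by simp
qed

lemma square_add_5_le_power2: "6 \<le> n \<Longrightarrow> n\<^sup>2 + 5 \<le> (2 :: nat) ^ n"
proof (induction n rule: nat_induct_at_least)
  case (Suc n)
  have "(Suc n)\<^sup>2 + 5 = n\<^sup>2 + 5 + (2 * n + 1)"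
    by (simp add: power2_eq_square)
  moreover have "2 * n + 1 \<le> n\<^sup>2 + 5"
    using mult_le_mono1[OF Suc.hyps, of n] unfolding power2_eq_square by linarith
  ultimately show ?case
    using Suc.IH by simp
qed simp

text \<open>Of the two factors in the recursion, the type count is at most \<open>2 ^ W\<close> by
  \<open>type_bound_le\<close>, and the previous length, at most the square of \<open>W\<close>, is
  absorbed by the same exponential. Their product is again a square.\<close>

lemma length_bound_le:
  assumes "2 \<le> k"
  shows "length_bound k (Suc n) \<le> (iter_exp (Suc n) (2 * k\<^sup>2 + 2))\<^sup>2"
proof (induction n)
  case 0
  define m where "m = 2 * k\<^sup>2"
  have "7 * m + 5 \<le> 8 * 2 ^ m"
    using less_exp[of m] by linarith
  then have "2 * 2 ^ m * (7 * m + 5) \<le> 2 * 2 ^ m * (8 * 2 ^ m)"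
    by (intro mult_le_mono2)
  also have "\<dots> = (2 ^ (m + 2))\<^sup>2"
    by (simp add: power2_eq_square power_add)
  finally show ?case
    by (simp add: m_def)
next
  case (Suc n)
  define W where "W = iter_exp (Suc n) (2 * k\<^sup>2 + 2)"
  have "2\<^sup>2 \<le> k\<^sup>2"
    using assms by (intro power_mono) auto
  then have "6 \<le> W"
    using iter_exp_ge[of "2 * k\<^sup>2 + 2" "Suc n"] by (simp add: W_def)
  have "2 * type_bound k (Suc n) \<le> 2 ^ W"
    using type_bound_le[of k "Suc n"] by (simp add: W_def)
  moreover have "length_bound k (Suc n) + 5 \<le> 2 ^ W"
    using Suc.IH square_add_5_le_power2[OF \<open>6 \<le> W\<close>] unfolding W_def by linarith
  ultimately have "2 * type_bound k (Suc n) * (length_bound k (Suc n) + 5) \<le> 2 ^ W * 2 ^ W"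
    by (rule mult_le_mono)
  then show ?case
    by (simp add: W_def power2_eq_square)
qed

text \<open>The summand 2 in the height of the final tower pays for this double exponential. The
  inequality fails for \<open>k = 0\<close> and \<open>k = 1\<close>.\<close>

lemma quadratic_less_double_exp: "2 \<le> k \<Longrightarrow> 2 * k\<^sup>2 + 3 < (2 :: nat) ^ (2 ^ k)"
proof (induction k rule: nat_induct_at_least)
  case (Suc k)
  have "2 * k \<le> k\<^sup>2"
    using Suc.hyps by (simp add: power2_eq_square)
  moreover have "2 * (Suc k)\<^sup>2 + 3 = 2 * k\<^sup>2 + 4 * k + 5"
    by (simp add: power2_eq_square)
  ultimately have "2 * (Suc k)\<^sup>2 + 3 \<le> 4 * (2 * k\<^sup>2 + 3)"
    by simp
  also have "\<dots> < 4 * 2 ^ (2 ^ k)"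
    using Suc.IH by simp
  also have "\<dots> = 2 ^ (2 + 2 ^ k)"
    by (simp add: power_add)
  also have "\<dots> \<le> 2 ^ (2 ^ Suc k)"
    using Suc.hyps power_increasing[of 1 k "2 :: nat"] by (intro power_increasing) auto
  finally show ?case .
qed simp

lemma length_bound_less_tower:
  assumes "2 \<le> k"
  shows "length_bound k k < tower (k + log_star k + 2)"
proof -
  define a where "a = 2 * k\<^sup>2 + 2"
  obtain n where k: "k = Suc (Suc n)"
    using assms by (metis add_2_eq_Suc le_Suc_ex)
  have "length_bound k k \<le> (iter_exp k a)\<^sup>2"
    using length_bound_le[OF assms, of "Suc n"] by (simp add: k a_def)
  \<comment> \<open>As k \<ge> 2, two outer exponentials can be split off; squaring
    \<open>2 ^ 2 ^ x\<close> raises \<open>x\<close> by 1.\<close>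
  also have "\<dots> = 2 ^ 2 ^ Suc (iter_exp n a)"
    by (simp add: k mult.commute flip: power_mult)
  \<comment> \<open>By strict monotonicity that 1 may be added at the bottom instead.\<close>
  also have "\<dots> \<le> 2 ^ 2 ^ iter_exp n (Suc a)"
    using iter_exp_strict_mono[of a "Suc a" n] by (intro power_increasing) auto
  also have "\<dots> = iter_exp k (Suc a)"
    by (simp add: k)
  also have "\<dots> < iter_exp k (tower (log_star k + 2))"
  proof (rule iter_exp_strict_mono)
    \<comment> \<open>Both sides carry \<open>k\<close> exponentials, so only their bottoms are
      compared, with \<open>k\<close> at most \<open>tower (log_star k)\<close>.\<close>
    have "Suc a < 2 ^ 2 ^ k"
      using quadratic_less_double_exp[OF assms] by (simp add: a_def)
    also have "\<dots> \<le> 2 ^ 2 ^ tower (log_star k)"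
      using le_tower_log_star by (intro power_increasing) auto
    finally show "Suc a < tower (log_star k + 2)"
      by simp
  qed
  also have "\<dots> = tower (k + log_star k + 2)"
    by (simp only: tower_add add.assoc)
  finally show ?thesis .
qed

section \<open>Succinct definitions in regular classes\<close>

lemma normal_wrt_sentence:
  assumes "normal_fm B" "sentence B" "0 < qrank B"
  obtains xs where "normal_wrt xs 0 B" "length xs = qrank B"
proof -
  obtain xs s where "normal_wrt xs s B"
    using assms(1) by (auto simp: normal_fm_def)
  moreover from this have "s = 0"
    using assms(2,3) by (auto simp: normal_wrt_def sentence_def)
  ultimately show thesis
    using that by (auto simp: normal_wrt_def)
qed

lemma nested_quants_nonempty: "0 < qrank A \<Longrightarrow> nested_quants A \<noteq> {}"
  by (induction A) (auto simp: max_def split: if_splits)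

lemma regular_class_short_definition:
  assumes "regular_class F" "nonempty_digraph G" "A \<in> F" "defines_digraph A G"
  shows "\<exists>C\<in>F. defines_digraph C G \<and> fm_length C \<le> length_bound (qrank A) (qrank A)"
proof -
  obtain B where B: "B \<in> F" "normal_form_of B A"
    using assms(1,3) unfolding regular_class_def by blast
  have B_def: "defines_digraph B G"
    using defines_digraph_equivalent[OF assms(4)] B(2) assms(2) by (auto simp: normal_form_of_def)
  define k where "k = qrank A"
  have qB: "qrank B = k"
    using B(2) by (simp add: normal_form_of_def k_def)
  have "2 \<le> k"
    using defines_digraph_qrank_ge_2[OF assms(4,2)] by (simp add: k_def)
  have "sentence B" "true_on B G"
    using B_def by (auto simp: defines_digraph_def)
  obtain xs where xs: "normal_wrt xs 0 B" "length xs = k"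
    using normal_wrt_sentence[of B] B(2) \<open>sentence B\<close> qB \<open>2 \<le> k\<close>
    by (auto simp: normal_form_of_def)
  have "xs \<noteq> []"
    using xs(2) \<open>2 \<le> k\<close> by auto
  define S where "S = map fst ` nested_quants B"
  have S: "S \<noteq> {}" "\<And>w. w \<in> S \<Longrightarrow> length w = length xs"
    using nested_quants_nonempty[of B] qB \<open>2 \<le> k\<close> xs(1)
    by (auto simp: S_def normal_wrt_def dest: arg_cong[of _ _ length])
  have G: "finite (pverts G)" "pverts G \<noteq> {}"
    using assms(2) by (auto simp: nonempty_digraph_iff)
  then obtain v where v: "v \<in> pverts G" by blast
  \<comment> \<open>The starting assignment is arbitrary, since all of \<open>xs\<close> gets
    quantified.\<close>
  define C where "C = char_fm xs xs S G (\<lambda>_. v)"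
  have C: "normal_matrix xs xs S C"
    unfolding C_def by (rule normal_matrix_char_fm[OF G \<open>xs \<noteq> []\<close> S]) auto
  have "sentence C"
    using C by (auto simp: normal_matrix_def sentence_def)
  have "normal_wrt xs 0 C"
    using C xs(1) by (auto simp: normal_matrix_def normal_wrt_def)
  then have "normal_fm C" "qrank C = k"
    using xs(2) unfolding normal_fm_def by (blast, simp add: normal_wrt_def)
  obtain P where P: "\<And>D. sentence D \<Longrightarrow> normal_fm D \<Longrightarrow> qrank D = k \<Longrightarrow>
      D \<in> F \<longleftrightarrow> (\<forall>q \<in> nested_quants D. map fst q \<in> P)"
    using assms(1) \<open>2 \<le> k\<close> unfolding regular_class_def
    by (metis one_le_numeral order_trans)
  \<comment> \<open>\<open>B\<close> lies in \<open>F\<close>, so its words lie in \<open>P\<close>;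
    \<open>C\<close> uses only words of \<open>S\<close> and has the same rank, hence it lies in
    \<open>F\<close> as well.\<close>
  have "S \<subseteq> P"
    using P[of B] B \<open>sentence B\<close> qB by (auto simp: normal_form_of_def S_def)
  then have "C \<in> F"
    using P[OF \<open>sentence C\<close> \<open>normal_fm C\<close> \<open>qrank C = k\<close>] C by (auto simp: normal_matrix_def)
  have "true_on C G"
    unfolding true_on_def C_def using sat_char_fm_self[OF G \<open>xs \<noteq> []\<close> S] by simp
  \<comment> \<open>\<open>C\<close> implies \<open>B\<close>, so it fails wherever \<open>B\<close>
    does, in particular on every digraph not isomorphic to \<open>G\<close>.\<close>
  have "true_on B H" if "nonempty_digraph H" "true_on C H" for H :: "nat pair_pre_digraph"
    unfolding true_on_def
  proof (intro allI impI)
    fix \<mu> :: "var \<Rightarrow> nat" assume "range \<mu> \<subseteq> pverts H"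
    then have sat_C: "sat H \<mu> (char_fm xs xs S G (\<lambda>_. v))"
      using that(2) by (auto simp: true_on_def C_def)
    have sat_B: "sat G (\<lambda>_. v) B"
      using \<open>true_on B G\<close> v by (auto simp: true_on_def)
    have "pverts H \<noteq> {}"
      using that(1) by (auto simp: nonempty_digraph_iff)
    then show "sat H \<mu> B"
      by (rule char_fm_strongest[OF G _ S sat_C _ _ _ _ _ sat_B])
        (use xs(1) in \<open>simp_all add: normal_wrt_def S_def\<close>)
  qed
  then have "defines_digraph C G"
    using B_def \<open>sentence C\<close> \<open>true_on C G\<close> by (auto simp: defines_digraph_def)
  moreover have "fm_length C \<le> length_bound k k"
    using fm_length_char_fm[OF G \<open>xs \<noteq> []\<close>, of xs] xs(2) by (simp add: C_def)
  ultimately show ?thesis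
    using \<open>C \<in> F\<close> by (auto simp: k_def)
qed

theorem theorem8:
  fixes F :: "fm set" and G :: "'a pair_pre_digraph"
  assumes "regular_class F"
    and "nonempty_digraph G"
    and "definable_in F G"
  shows "def_length F G < tower (def_qrank F G + log_star (def_qrank F G) + 2)"
proof -
  have "\<exists>d. \<exists>A\<in>F. defines_digraph A G \<and> qrank A = d"
    using assms(3) by (auto simp: definable_in_def)
  then have "\<exists>A\<in>F. defines_digraph A G \<and> qrank A = def_qrank F G"
    unfolding def_qrank_def by (rule LeastI_ex)
  \<comment> \<open>A definition of least rank is taken, as the length obtained from it is bounded
    in terms of the rank alone.\<close>
  then obtain A where A: "A \<in> F" "defines_digraph A G" "qrank A = def_qrank F G"
    by blast
  obtain C where C: "C \<in> F" "defines_digraph C G"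
    "fm_length C \<le> length_bound (def_qrank F G) (def_qrank F G)"
    using regular_class_short_definition[OF assms(1,2) A(1,2)] A(3) by auto
  have "def_length F G \<le> fm_length C"
    unfolding def_length_def using C by (intro Least_le) blast
  also note C(3)
  also have "length_bound (def_qrank F G) (def_qrank F G) <
      tower (def_qrank F G + log_star (def_qrank F G) + 2)"
    using length_bound_less_tower defines_digraph_qrank_ge_2[OF A(2) assms(2)] A(3) by simp
  finally show ?thesis .
qed

end
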